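(* Let $\beta$ be a unit-speed timelike curve in $\mathbb{E}^4_1$ with Frenet frame $\{F_1,F_2,F_3,F_4\}$, let $r>0$ be constant, and let $M$ be the tubular hypersurface $$\mathcal{T}(s,t,w)=\beta(s)+r(\cos t\cos w\,F_2(s)+\sin t\cos w\,F_3(s)+\sin w\,F_4(s))$$ in $\mathbb{E}^4_1$, with Gauss map $N=-(\cos t\cos w\,F_2+\sin t\cos w\,F_3+\sin w\,F_4)$. Then $M$ does not have second kind $\mathcal{L}_1$-pointwise 1-type Gauss map; that is, there do not exist a non-zero smooth function $\mathfrak{m}$ on $M$ and a non-zero constant vector $C\in\mathbb{E}^4_1$ such that $\mathcal{L}_1N=\mathfrak{m}(N+C)$.
   Context: $\mathbb{E}^4_1$ is $\mathbb{R}^4$ with the metric $\langle\ ,\ \rangle=-dx_1^2+dx_2^2+dx_3^2+dx_4^2$. The curve $\beta:I\to\mathbb{E}^4_1$ ($I$ an open interval) is smooth with $\beta'=F_1$, and $\{F_1,F_2,F_3,F_4\}$ is a smooth orthonormal frame along $\beta$ with $\langle F_1,F_1\rangle=-1$, $\langle F_i,F_i\rangle=1$ ($i=2,3,4$), satisfying the Frenet equations $F_1'=k_1F_2$, $F_2'=k_1F_1+k_2F_3$, $F_3'=-k_2F_2+k_3F_4$, $F_4'=-k_3F_3$, where $k_1,k_2,k_3$ are smooth functions of $s$ (the curvatures of $\beta$). The parameters $(s,t,w)$ range over a connected open set $U\subset I\times\mathbb{R}^2$ projecting onto $I$ on which $\mathcal{T}$ is an immersion, i.e. $\cos w\neq0$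 and $1+rk_1\cos t\cos w\neq0$. The unit normal $N$ has $\varepsilon=\langle N,N\rangle=1$, and the principal curvatures with respect to $N$ (eigenvalues of the shape operator $-dN$) are $\kappa_1=\kappa_2=\frac1r$, $\kappa_3=\frac{k_1\cos t\cos w}{1+rk_1\cos t\cos w}$. Operator $\mathcal{L}_1$ (Cheng–Yau) on the Gauss map: put $a_1=-\sum_i\kappa_i$, $a_k=(-1)^k\sum_{i_1<\dots<i_k}\kappa_{i_1}\cdots\kappa_{i_k}$ ($k=2,3$), and define $H_k$ by $\binom{3}{k}H_k=(-\varepsilon)^ka_k$. Then $$\mathcal{L}_1N=-\varepsilon\,\mathfrak{C}_1\big(\nabla H_2+(3H_1H_2-H_3)N\big),\qquad \mathfrak{C}_1=\binom32(-\varepsilon)=-3\varepsilon,$$ where $\nabla$ is the gradient on $M$ with respect to the induced metric, viewed as an $\mathbb{E}^4_1$-valued map. "Non-zero function" means not identically zero. *)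

theory Defs
  imports "HOL-Analysis.Analysis"
begin

primrec Ck_on :: "nat \<Rightarrow> 'a::real_normed_vector set \<Rightarrow> ('a \<Rightarrow> 'b::real_normed_vector) \<Rightarrow> bool" where
  "Ck_on 0 S f \<longleftrightarrow> continuous_on S f"
| "Ck_on (Suc n) S f \<longleftrightarrow>
     (\<forall>x\<in>S. f differentiable (at x)) \<and>
     (\<forall>v. Ck_on n S (\<lambda>x. frechet_derivative f (at x) v))"

(* Only used on open sets S. *)
definition smooth_on :: "'a::real_normed_vector set \<Rightarrow> ('a \<Rightarrow> 'b::real_normed_vector) \<Rightarrow> bool" where
  "smooth_on S f \<longleftrightarrow> (\<forall>n. Ck_on n S f)"

definition lorentz :: "real^4 \<Rightarrow> real^4 \<Rightarrow> real" where
  "lorentz x y = - (x$1 * y$1) + x$2 * y$2 + x$3 * y$3 + x$4 * y$4"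

definition timelike_frenet_curve ::
  "real set \<Rightarrow> (real \<Rightarrow> real^4) \<Rightarrow> (4 \<Rightarrow> real \<Rightarrow> real^4) \<Rightarrow>
   (real \<Rightarrow> real) \<Rightarrow> (real \<Rightarrow> real) \<Rightarrow> (real \<Rightarrow> real) \<Rightarrow> bool" where
  "timelike_frenet_curve I \<beta> F k1 k2 k3 \<longleftrightarrow>
     smooth_on I \<beta> \<and> (\<forall>i. smooth_on I (F i)) \<and>
     smooth_on I k1 \<and> smooth_on I k2 \<and> smooth_on I k3 \<and>
     (\<forall>s\<in>I.
       (\<forall>i j. lorentz (F i s) (F j s) = (if i \<noteq> j then 0 else if i = 1 then -1 else 1)) \<and>
       (\<beta> has_vector_derivative F 1 s) (at s) \<and>
       (F 1 has_vector_derivative k1 s *\<^sub>R F 2 s) (at s) \<and>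
       (F 2 has_vector_derivative k1 s *\<^sub>R F 1 s + k2 s *\<^sub>R F 3 s) (at s) \<and>
       (F 3 has_vector_derivative - (k2 s *\<^sub>R F 2 s) + k3 s *\<^sub>R F 4 s) (at s) \<and>
       (F 4 has_vector_derivative - (k3 s *\<^sub>R F 3 s)) (at s))"

(* Hypersurfaces are parametrized over real^3; for the tubular hypersurface
   the parameter point p has coordinates (s, t, w) = (p$1, p$2, p$3). *)

definition tubular_hypersurface ::
  "(real \<Rightarrow> real^4) \<Rightarrow> (4 \<Rightarrow> real \<Rightarrow> real^4) \<Rightarrow> real \<Rightarrow> real^3 \<Rightarrow> real^4" where
  "tubular_hypersurface \<beta> F r p =
     \<beta> (p$1) + r *\<^sub>R ((cos (p$2) * cos (p$3)) *\<^sub>R F 2 (p$1)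
                   + (sin (p$2) * cos (p$3)) *\<^sub>R F 3 (p$1)
                   + sin (p$3) *\<^sub>R F 4 (p$1))"

definition tubular_gauss_map :: "(4 \<Rightarrow> real \<Rightarrow> real^4) \<Rightarrow> real^3 \<Rightarrow> real^4" where
  "tubular_gauss_map F p =
     - ((cos (p$2) * cos (p$3)) *\<^sub>R F 2 (p$1)
        + (sin (p$2) * cos (p$3)) *\<^sub>R F 3 (p$1)
        + sin (p$3) *\<^sub>R F 4 (p$1))"

definition immersion_on :: "(real^3) set \<Rightarrow> (real^3 \<Rightarrow> real^4) \<Rightarrow> bool" where
  "immersion_on U X \<longleftrightarrow>
     (\<forall>p\<in>U. X differentiable (at p) \<and> inj (frechet_derivative X (at p)))"

(* Matrix of the shape operator -dN in the coordinate basis: tangent vectors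
   of the hypersurface are written as dX v with v in real^3, and the matrix S
   is determined by dX (S v) = - dN v. *)
definition shape_operator :: "(real^3 \<Rightarrow> real^4) \<Rightarrow> (real^3 \<Rightarrow> real^4) \<Rightarrow> real^3 \<Rightarrow> real^3^3" where
  "shape_operator X N p =
     (THE S. \<forall>v. frechet_derivative X (at p) (S *v v) = - frechet_derivative N (at p) v)"

(* The eigenvalues of the shape operator, counted with algebraic multiplicity.
   The choice only fixes their order; only symmetric functions of them are used. *)
definition principal_curvatures :: "(real^3 \<Rightarrow> real^4) \<Rightarrow> (real^3 \<Rightarrow> real^4) \<Rightarrow> real^3 \<Rightarrow> real^3" where
  "principal_curvatures X N p =
     (SOME \<kappa>. \<forall>x. det (mat x - shape_operator X N p) = (\<Prod>i\<in>UNIV. x - \<kappa>$i))"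

definition curvature_coeff :: "(real^3 \<Rightarrow> real^4) \<Rightarrow> (real^3 \<Rightarrow> real^4) \<Rightarrow> nat \<Rightarrow> real^3 \<Rightarrow> real" where
  "curvature_coeff X N k p =
     (-1) ^ k * (\<Sum>J | J \<subseteq> (UNIV :: 3 set) \<and> card J = k. \<Prod>i\<in>J. principal_curvatures X N p $ i)"

definition normal_sign :: "(real^3 \<Rightarrow> real^4) \<Rightarrow> real^3 \<Rightarrow> real" where
  "normal_sign N p = lorentz (N p) (N p)"

definition mean_curvature :: "(real^3 \<Rightarrow> real^4) \<Rightarrow> (real^3 \<Rightarrow> real^4) \<Rightarrow> nat \<Rightarrow> real^3 \<Rightarrow> real" where
  "mean_curvature X N k p =
     (- normal_sign N p) ^ k * curvature_coeff X N k p / real (3 choose k)"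

(* Gradient with respect to the induced metric, as a vector of the ambient space:
   the tangent vector G with <G, dX v> = df v for all v. *)
definition hypersurface_gradient :: "(real^3 \<Rightarrow> real^4) \<Rightarrow> (real^3 \<Rightarrow> real) \<Rightarrow> real^3 \<Rightarrow> real^4" where
  "hypersurface_gradient X f p =
     (THE G. G \<in> range (frechet_derivative X (at p)) \<and>
        (\<forall>v. lorentz G (frechet_derivative X (at p) v) = frechet_derivative f (at p) v))"

(* The value of the Cheng-Yau operator L_1 on the Gauss map N of X:
   L_1 N = - eps * C_1 * (grad H_2 + (3 H_1 H_2 - H_3) N),  C_1 = (3 choose 2) * (- eps). *)
definition L1_gauss_map :: "(real^3 \<Rightarrow> real^4) \<Rightarrow> (real^3 \<Rightarrow> real^4) \<Rightarrow> real^3 \<Rightarrow> real^4" where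
  "L1_gauss_map X N p =
     (let \<epsilon> = normal_sign N p;
          C1 = real (3 choose 2) * (- \<epsilon>);
          H = (\<lambda>k. mean_curvature X N k p)
      in (- \<epsilon> * C1) *\<^sub>R
           (hypersurface_gradient X (mean_curvature X N 2) p + (3 * H 1 * H 2 - H 3) *\<^sub>R N p))"

(* Functions on the (possibly only immersed) hypersurface are functions of the
   parameter; non-zero means not identically zero. *)
definition second_kind_L1_pointwise_1_type ::
  "(real^3) set \<Rightarrow> (real^3 \<Rightarrow> real^4) \<Rightarrow> (real^3 \<Rightarrow> real^4) \<Rightarrow> bool" where
  "second_kind_L1_pointwise_1_type U X N \<longleftrightarrow>
     (\<exists>(m :: real^3 \<Rightarrow> real) (C :: real^4).
        smooth_on U m \<and> (\<exists>p\<in>U. m p \<noteq> 0) \<and> C \<noteq> 0 \<and>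
        (\<forall>p\<in>U. L1_gauss_map X N p = m p *\<^sub>R (N p + C)))"

end

theory Submission
  imports Defs
begin

text \<open>
  With \<open>g = k1 cos t cos w\<close>, \<open>\<kappa> = g / (1 + r g)\<close> and \<open>q = 1/r\<^sup>2 + \<kappa>/r + \<kappa>\<^sup>2\<close> one finds
  \<open>L1 N = (2/r) (grad \<kappa> + q N)\<close>. If this equals \<open>m (N + C)\<close>, comparing the inner products with \<open>N\<close>
  and with the tangent vectors and eliminating \<open>m\<close> gives
  \<open>dg(v) (1 + <N,C>) r\<^sup>2 = (1 + 3 r g + 3 r\<^sup>2 g\<^sup>2) <C, dX v>\<close>.
  For fixed \<open>s\<close> the angular directions show that \<open>dg\<close> and \<open>d<N,C>\<close> are parallel on an open piece of the
  sphere, so that \<open>C\<close> is orthogonal to \<open>F3\<close> and \<open>F4\<close>; what remains is a quadratic polynomial in \<open>cos t\<close>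
  whose vanishing forces \<open>k1 = 0\<close> and \<open><C,F2> = 0\<close>. As \<open>k1\<close> then vanishes identically, so does \<open>dg\<close>,
  and the direction of \<open>s\<close> gives \<open><C,F1> = 0\<close>, hence \<open>C = 0\<close>.
\<close>

section \<open>Infinite sets of sine and cosine values\<close>

text \<open>Supplies infinitely many roots of a polynomial in \<open>cos t\<close> at points where
  dividing by \<open>sin t\<close> is allowed. On a ball free of zeros of \<open>sin\<close>,
  Rolle's theorem makes \<open>cos\<close> injective.\<close>

lemma infinite_cos_image:
  fixes a b :: real
  assumes "a < b"
  shows "infinite (cos ` {t \<in> {a<..<b}. sin t \<noteq> 0})"
proof -
  define c where "c = (a + b) / 2"
  have c: "a < c" "c < b" using assms by (auto simp: c_def)
  \<comment> \<open>The bound \<open>e < pi\<close> gives \<open>sin e > 0\<close>, so by the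
    addition formula \<open>c\<close> and \<open>c + e\<close> cannot both be zeros of the
    sine.\<close>
  obtain e where e: "0 < e" "e < pi" "c + e < b"
    using c pi_gt_zero field_lbound_gt_zero[of pi "b - c"] by (metis diff_gt_0_iff_gt less_diff_eq add.commute)
  have "sin c \<noteq> 0 \<or> sin (c + e) \<noteq> 0"
  proof (rule ccontr)
    assume "\<not> ?thesis"
    moreover have "sin e > 0" using e sin_gt_zero by blast
    moreover have "sin (c + e) = sin c * cos e + cos c * sin e" by (rule sin_add)
    ultimately have "sin c = 0" "cos c = 0" by auto
    then show False using sin_cos_squared_add[of c] by simp
  qed
  then obtain x where x: "x \<in> {t \<in> {a<..<b}. sin t \<noteq> 0}"
    using c e by (metis (mono_tags, lifting) add_strict_increasing2 greaterThanLessThan_iff less_add_same_cancel1 less_trans mem_Collect_eq)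
  have "open {t. sin t \<noteq> (0::real)}"
    by (intro open_Collect_neq continuous_intros)
  then have "open {t \<in> {a<..<b}. sin t \<noteq> (0::real)}"
    by (simp add: Collect_conj_eq open_Int greaterThanLessThan_def greaterThan_def lessThan_def open_Collect_less)
  with x obtain d where d: "d > 0" "ball x d \<subseteq> {t \<in> {a<..<b}. sin t \<noteq> 0}"
    by (meson openE)
  have "inj_on cos (ball x d)"
  proof (rule linorder_inj_onI)
    fix u v assume uv: "u < v" "u \<in> ball x d" "v \<in> ball x d"
    show "cos u \<noteq> cos v"
    proof
      assume "cos u = cos v"
      moreover have "continuous_on {u..v} cos" by (intro continuous_intros)
      ultimately obtain z where z: "u < z" "z < v" "DERIV cos z :> 0"
        using Rolle[of u v cos] uv(1) by (auto simp: real_differentiable_def intro: DERIV_cos)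
      have "- sin z = 0" using DERIV_unique[OF DERIV_cos z(3)] .
      moreover have "z \<in> ball x d" using uv z by (auto simp: dist_real_def)
      ultimately show False using d by auto
    qed
  qed auto
  moreover have "infinite (ball x d)"
    using d(1) by (simp add: ball_eq_greaterThanLessThan)
  ultimately have "infinite (cos ` ball x d)" using finite_imageD by blast
  then show ?thesis using d(2) by (meson finite_subset image_mono)
qed

lemma infinite_sin_image:
  fixes a b :: real
  assumes "a < b"
  shows "infinite (sin ` {a<..<b})"
proof -
  have "infinite (cos ` {t \<in> {pi/2-b<..<pi/2-a}. sin t \<noteq> 0})"
    using assms by (intro infinite_cos_image) simp
  moreover have "cos ` {t \<in> {pi/2-b<..<pi/2-a}. sin t \<noteq> 0} \<subseteq> sin ` {a<..<b}"
  proof (rule image_subsetI)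
    fix t assume "t \<in> {t \<in> {pi/2-b<..<pi/2-a}. sin t \<noteq> 0}"
    then have "pi/2 - t \<in> {a<..<b}" by auto
    moreover have "cos t = sin (pi/2 - t)" by (simp add: cos_sin_eq)
    ultimately show "cos t \<in> sin ` {a<..<b}" by (rule image_eqI[rotated])
  qed
  ultimately show ?thesis using finite_subset by blast
qed

section \<open>Linear algebra of the Lorentz product\<close>

lemma lorentz_linear [simp]:
  "lorentz (x + y) z = lorentz x z + lorentz y z"
  "lorentz x (y + z) = lorentz x y + lorentz x z"
  "lorentz (x - y) z = lorentz x z - lorentz y z"
  "lorentz x (y - z) = lorentz x y - lorentz x z"
  "lorentz (- x) z = - lorentz x z"
  "lorentz x (- z) = - lorentz x z"
  "lorentz (c *\<^sub>R x) z = c * lorentz x z"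
  "lorentz x (c *\<^sub>R z) = c * lorentz x z"
  "lorentz 0 z = 0"
  "lorentz x 0 = 0"
  by (simp_all add: lorentz_def algebra_simps)

lemma lorentz_commute: "lorentz x y = lorentz y x"
  by (simp add: lorentz_def mult.commute)

text \<open>Orthonormality says that the frame matrix \<open>A\<close> has the right inverse
  \<open>B\<close>, its transpose conjugated by the signature. For square matrices \<open>B\<close>
  is then also a left inverse, so \<open>A\<close> kills only zero.\<close>

lemma orthonormal_frame_complete:
  fixes E :: "4 \<Rightarrow> real^4"
  assumes E: "\<And>i j. lorentz (E i) (E j) = (if i \<noteq> j then 0 else if i = 1 then -1 else 1)"
    and C: "\<And>i. lorentz (E i) C = 0"
  shows "C = 0"
proof -
  define \<eta> :: "4 \<Rightarrow> real" where "\<eta> i = (if i = 1 then -1 else 1)" for i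
  define A :: "real^4^4" where "A = (\<chi> i j. E i $ j)"
  define B :: "real^4^4" where "B = (\<chi> i j. \<eta> i * \<eta> j * E j $ i)"
  have lor: "lorentz x y = (\<Sum>i\<in>UNIV. \<eta> i * x$i * y$i)" for x y
    by (simp add: lorentz_def sum_4 \<eta>_def)
  have "A ** B = mat 1"
  proof -
    have "(A ** B) $ i $ j = mat 1 $ i $ j" for i j
    proof -
      have "(A ** B) $ i $ j = \<eta> j * lorentz (E i) (E j)"
        by (simp add: lor matrix_matrix_mult_def A_def B_def sum_distrib_left mult_ac)
      also have "\<dots> = mat 1 $ i $ j" using E[of i j] by (auto simp: mat_def \<eta>_def)
      finally show ?thesis .
    qed
    then show ?thesis by (simp add: vec_eq_iff)
  qed
  then have BA: "B ** A = mat 1" using matrix_left_right_inverse by blast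
  define D where "D = (\<chi> i. \<eta> i * C$i)"
  have "A *v D = 0"
    using C by (simp add: vec_eq_iff matrix_vector_mult_def A_def D_def lor mult_ac)
  then have "D = 0"
    by (metis BA matrix_vector_mul_assoc matrix_vector_mul_lid matrix_vector_mult_0_right)
  then show "C = 0" by (auto simp: vec_eq_iff D_def \<eta>_def split: if_splits)
qed

section \<open>Symmetric functions of the principal curvatures\<close>

lemma subsets_3_card:
  "{J. J \<subseteq> (UNIV :: 3 set) \<and> card J = 1} = {{1}, {2}, {3}}"
  "{J. J \<subseteq> (UNIV :: 3 set) \<and> card J = 2} = {{1,2}, {1,3}, {2,3}}"
  "{J. J \<subseteq> (UNIV :: 3 set) \<and> card J = 3} = {UNIV}"
proof -
  show "{J. J \<subseteq> (UNIV :: 3 set) \<and> card J = 1} = {{1}, {2}, {3}}"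
    using exhaust_3 by (fastforce simp: card_1_singleton_iff)
  show "{J. J \<subseteq> (UNIV :: 3 set) \<and> card J = 2} = {{1,2}, {1,3}, {2,3}}"
  proof (intro set_eqI iffI)
    fix J :: "3 set" assume "J \<in> {J. J \<subseteq> UNIV \<and> card J = 2}"
    then obtain x y where "J = {x, y}" "x \<noteq> y" by (auto simp: card_2_iff)
    then show "J \<in> {{1,2}, {1,3}, {2,3}}"
      using exhaust_3[of x] exhaust_3[of y] by auto
  qed auto
  show "{J. J \<subseteq> (UNIV :: 3 set) \<and> card J = 3} = {UNIV}"
    using card_eq_UNIV_imp_eq_UNIV[of "_ :: 3 set"] by auto
qed

text \<open>The chosen eigenvalues are known only up to order, but their elementary symmetric
  functions are, up to sign, coefficients of the characteristic polynomial.\<close>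

lemma curvature_coeff_eq:
  fixes X N :: "real^3 \<Rightarrow> real^4"
  assumes det: "\<And>x. det (mat x - shape_operator X N p) = (x - a) * (x - b) * (x - c)"
  shows "curvature_coeff X N 1 p = - (a + b + c)"
    and "curvature_coeff X N 2 p = a * b + a * c + b * c"
    and "curvature_coeff X N 3 p = - (a * b * c)"
proof -
  define \<kappa> where "\<kappa> = principal_curvatures X N p"
  \<comment> \<open>The choice in \<open>principal_curvatures\<close> is over a nonempty set because \<open>(a, b, c)\<close> is a candidate.\<close>
  have "\<forall>x. det (mat x - shape_operator X N p) = (\<Prod>i\<in>UNIV. x - vector [a, b, c] $ (i::3))"
    unfolding det UNIV_3 by (simp add: mult.assoc)
  then have "\<exists>\<kappa>. \<forall>x. det (mat x - shape_operator X N p) = (\<Prod>i\<in>(UNIV::3 set). x - \<kappa> $ i)"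
    by (rule exI[where P = "\<lambda>\<kappa>. \<forall>x. _ x = (\<Prod>i\<in>UNIV. x - \<kappa> $ i)"])
  then have "\<forall>x. det (mat x - shape_operator X N p) = (\<Prod>i\<in>UNIV. x - \<kappa> $ i)"
    unfolding \<kappa>_def principal_curvatures_def by (rule someI_ex)
  then have *: "(x - a) * (x - b) * (x - c) = (x - \<kappa>$1) * (x - \<kappa>$2) * (x - \<kappa>$3)" for x
    unfolding det UNIV_3 by (simp add: mult.assoc)
  have cubic: "(x - u) * (x - v) * (x - w) = x^3 - (u + v + w) * x\<^sup>2 + (u * v + u * w + v * w) * x - u * v * w"
    for x u v w :: real
    by (simp add: power2_eq_square power3_eq_cube ring_distribs)
  \<comment> \<open>The cubic terms agree, so the values at 0, 1 and -1 determine the three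
    remaining coefficients.\<close>
  have coeffs: "s1 = t1 \<and> s2 = t2 \<and> s3 = t3"
    if "\<And>x::real. x^3 - s1 * x\<^sup>2 + s2 * x - s3 = x^3 - t1 * x\<^sup>2 + t2 * x - t3" for s1 s2 s3 t1 t2 t3
    using that[of 0] that[of 1] that[of "-1"] by simp
  have 1: "a + b + c = \<kappa>$1 + \<kappa>$2 + \<kappa>$3"
    and 2: "a * b + a * c + b * c = \<kappa>$1 * \<kappa>$2 + \<kappa>$1 * \<kappa>$3 + \<kappa>$2 * \<kappa>$3"
    and 3: "a * b * c = \<kappa>$1 * \<kappa>$2 * \<kappa>$3"
    using coeffs[OF *[unfolded cubic]] by blast+
  show "curvature_coeff X N 1 p = - (a + b + c)"
    unfolding curvature_coeff_def subsets_3_card 1 \<kappa>_def[symmetric] by simp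
  show "curvature_coeff X N 2 p = a * b + a * c + b * c"
    unfolding curvature_coeff_def subsets_3_card 2 \<kappa>_def[symmetric]
    by (simp add: doubleton_eq_iff)
  show "curvature_coeff X N 3 p = - (a * b * c)"
    unfolding curvature_coeff_def subsets_3_card 3 \<kappa>_def[symmetric]
    unfolding UNIV_3 by (simp add: mult.assoc)
qed

section \<open>Adapted frame and differentials of the tube\<close>

lemma has_derivative_compose_component:
  fixes G :: "real \<Rightarrow> 'a::real_normed_vector"
  assumes "(G has_vector_derivative D) (at (p$i))"
  shows "((\<lambda>p. G (p$i)) has_derivative (\<lambda>v. v$i *\<^sub>R D)) (at p)"
  using has_derivative_compose[OF bounded_linear.has_derivative[OF bounded_linear_vec_nth[of i] has_derivative_ident]
    assms[unfolded has_vector_derivative_def]] by simp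

locale tubular_frenet =
  fixes I :: "real set" and U :: "(real^3) set"
    and \<beta> :: "real \<Rightarrow> real^4" and F :: "4 \<Rightarrow> real \<Rightarrow> real^4"
    and k1 k2 k3 :: "real \<Rightarrow> real" and r :: real
  assumes openI: "open I"
    and frenet: "timelike_frenet_curve I \<beta> F k1 k2 k3"
    and r_pos: "r > 0"
    and openU: "open U" and U_proj: "(\<lambda>p. p$1) ` U = I"
    and immersion: "immersion_on U (tubular_hypersurface \<beta> F r)"
begin

text \<open>
  \<open>F 1\<close>, \<open>e2\<close>, \<open>e3\<close>, \<open>N\<close> is an orthonormal frame along the hypersurface. The coefficients \<open>a\<close> and \<open>b\<close> record the
  rotation of \<open>F 2\<close>, \<open>F 3\<close>, \<open>F 4\<close> along the curve: up to sign, \<open>N\<close> has the \<open>s\<close>-derivative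
  \<open>g F 1 + a e2 + b e3\<close>.
\<close>

abbreviation X where "X \<equiv> tubular_hypersurface \<beta> F r"
abbreviation N where "N \<equiv> tubular_gauss_map F"

definition e2 :: "real^3 \<Rightarrow> real^4" where
  "e2 p = cos (p$2) *\<^sub>R F 3 (p$1) - sin (p$2) *\<^sub>R F 2 (p$1)"

definition e3 :: "real^3 \<Rightarrow> real^4" where
  "e3 p = cos (p$3) *\<^sub>R F 4 (p$1) - (cos (p$2) * sin (p$3)) *\<^sub>R F 2 (p$1)
     - (sin (p$2) * sin (p$3)) *\<^sub>R F 3 (p$1)"

definition g :: "real^3 \<Rightarrow> real" where
  "g p = k1 (p$1) * cos (p$2) * cos (p$3)"

definition dg :: "real^3 \<Rightarrow> real^3 \<Rightarrow> real" where
  "dg p v = v$1 * deriv k1 (p$1) * cos (p$2) * cos (p$3)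
     - v$2 * k1 (p$1) * sin (p$2) * cos (p$3) - v$3 * k1 (p$1) * cos (p$2) * sin (p$3)"

definition a where "a p = k2 (p$1) * cos (p$3) - k3 (p$1) * cos (p$2) * sin (p$3)"
definition b where "b p = k3 (p$1) * sin (p$2)"

definition dN :: "real^3 \<Rightarrow> real^3 \<Rightarrow> real^4" where
  "dN p v = - ((v$1 * g p) *\<^sub>R F 1 (p$1) + (v$1 * a p + v$2 * cos (p$3)) *\<^sub>R e2 p
     + (v$1 * b p + v$3) *\<^sub>R e3 p)"

text \<open>The \<open>e2\<close> and \<open>e3\<close> coefficients are \<open>r\<close> times
  those of \<open>- dN p v\<close>; this is the source of the double principal curvature
  \<open>1/r\<close>.\<close>

definition dX :: "real^3 \<Rightarrow> real^3 \<Rightarrow> real^4" where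
  "dX p v = (v$1 * (1 + r * g p)) *\<^sub>R F 1 (p$1)
     + (r * (v$1 * a p + v$2 * cos (p$3))) *\<^sub>R e2 p + (r * (v$1 * b p + v$3)) *\<^sub>R e3 p"

text \<open>The principal curvature that differs from \<open>1/r\<close>.\<close>

definition \<kappa> :: "real^3 \<Rightarrow> real" where "\<kappa> p = g p / (1 + r * g p)"

lemma frame_inner:
  assumes "s \<in> I"
  shows "lorentz (F i s) (F j s) = (if i \<noteq> j then 0 else if i = 1 then -1 else 1)"
  using assms frenet unfolding timelike_frenet_curve_def by blast

lemma frame_deriv:
  assumes "s \<in> I"
  shows "(\<beta> has_vector_derivative F 1 s) (at s)"
    and "(F 2 has_vector_derivative k1 s *\<^sub>R F 1 s + k2 s *\<^sub>R F 3 s) (at s)"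
    and "(F 3 has_vector_derivative - (k2 s *\<^sub>R F 2 s) + k3 s *\<^sub>R F 4 s) (at s)"
    and "(F 4 has_vector_derivative - (k3 s *\<^sub>R F 3 s)) (at s)"
  using assms frenet unfolding timelike_frenet_curve_def by blast+

lemma k1_deriv:
  assumes "s \<in> I"
  shows "(k1 has_vector_derivative deriv k1 s) (at s)"
proof -
  have "Ck_on (Suc 0) I k1"
    using frenet unfolding timelike_frenet_curve_def smooth_on_def by blast
  then have "k1 differentiable (at s)" using assms by simp
  then show ?thesis
    by (metis DERIV_deriv_iff_real_differentiable has_real_derivative_iff_has_vector_derivative)
qed

context
  fixes p assumes pU: "p \<in> U"
begin

lemma p_I: "p$1 \<in> I"
  using pU U_proj by blast

lemmas F_inner = frame_inner[OF p_I]

lemma adapted_frame_inner: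
  "lorentz (F 1 (p$1)) (F 1 (p$1)) = -1" "lorentz (F 1 (p$1)) (e2 p) = 0"
  "lorentz (F 1 (p$1)) (e3 p) = 0" "lorentz (F 1 (p$1)) (N p) = 0"
  "lorentz (e2 p) (F 1 (p$1)) = 0" "lorentz (e2 p) (e2 p) = 1"
  "lorentz (e2 p) (e3 p) = 0" "lorentz (e2 p) (N p) = 0"
  "lorentz (e3 p) (F 1 (p$1)) = 0" "lorentz (e3 p) (e2 p) = 0"
  "lorentz (e3 p) (e3 p) = 1" "lorentz (e3 p) (N p) = 0"
  "lorentz (N p) (F 1 (p$1)) = 0" "lorentz (N p) (e2 p) = 0"
  "lorentz (N p) (e3 p) = 0" "lorentz (N p) (N p) = 1"
proof -
  have t: "sin (p$2) * sin (p$2) = 1 - cos (p$2) * cos (p$2)"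
    and w: "sin (p$3) * sin (p$3) = 1 - cos (p$3) * cos (p$3)"
    using sin_squared_eq[of "p$2"] sin_squared_eq[of "p$3"] by (simp_all add: power2_eq_square)
  \<comment> \<open>Copies of the Pythagorean identity with a trailing factor, so that it also
    rewrites inside right-nested products.\<close>
  have t': "sin (p$2) * (sin (p$2) * x) = x - cos (p$2) * (cos (p$2) * x)" for x
    using t by algebra
  have w': "sin (p$3) * (sin (p$3) * x) = x - cos (p$3) * (cos (p$3) * x)" for x
    using w by algebra
  note defs = e2_def e3_def tubular_gauss_map_def F_inner t w t' w' algebra_simps
  show "lorentz (F 1 (p$1)) (F 1 (p$1)) = -1" by (simp add: defs)
  show "lorentz (F 1 (p$1)) (e2 p) = 0" "lorentz (e2 p) (F 1 (p$1)) = 0" by (simp_all add: defs)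
  show "lorentz (F 1 (p$1)) (e3 p) = 0" "lorentz (e3 p) (F 1 (p$1)) = 0" by (simp_all add: defs)
  show "lorentz (F 1 (p$1)) (N p) = 0" "lorentz (N p) (F 1 (p$1)) = 0" by (simp_all add: defs)
  show "lorentz (e2 p) (e2 p) = 1" by (simp add: defs)
  show "lorentz (e3 p) (e3 p) = 1" by (simp add: defs)
  show "lorentz (N p) (N p) = 1" by (simp add: defs)
  show "lorentz (e2 p) (e3 p) = 0" "lorentz (e3 p) (e2 p) = 0" by (simp_all add: defs)
  show "lorentz (e2 p) (N p) = 0" "lorentz (N p) (e2 p) = 0" by (simp_all add: defs)
  show "lorentz (e3 p) (N p) = 0" "lorentz (N p) (e3 p) = 0" by (simp_all add: defs)
qed

text \<open>The right-hand side is what the product rule and the Frenet equations produce directly;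
  the rotated frame absorbs it by the Pythagorean identities.\<close>

lemma dN_eq:
  "dN p v = - (
     v$1 *\<^sub>R ((cos (p$2) * cos (p$3)) *\<^sub>R (k1 (p$1) *\<^sub>R F 1 (p$1) + k2 (p$1) *\<^sub>R F 3 (p$1))
       + (sin (p$2) * cos (p$3)) *\<^sub>R (- (k2 (p$1) *\<^sub>R F 2 (p$1)) + k3 (p$1) *\<^sub>R F 4 (p$1))
       - (sin (p$3) * k3 (p$1)) *\<^sub>R F 3 (p$1))
     + (v$2 * cos (p$3)) *\<^sub>R e2 p + v$3 *\<^sub>R e3 p)"
proof -
  have t: "sin (p$2) * sin (p$2) = 1 - cos (p$2) * cos (p$2)"
    and w: "sin (p$3) * sin (p$3) = 1 - cos (p$3) * cos (p$3)"
    using sin_squared_eq[of "p$2"] sin_squared_eq[of "p$3"] by (simp_all add: power2_eq_square)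
  have "dN p v $ i = (- (
     v$1 *\<^sub>R ((cos (p$2) * cos (p$3)) *\<^sub>R (k1 (p$1) *\<^sub>R F 1 (p$1) + k2 (p$1) *\<^sub>R F 3 (p$1))
       + (sin (p$2) * cos (p$3)) *\<^sub>R (- (k2 (p$1) *\<^sub>R F 2 (p$1)) + k3 (p$1) *\<^sub>R F 4 (p$1))
       - (sin (p$3) * k3 (p$1)) *\<^sub>R F 3 (p$1))
     + (v$2 * cos (p$3)) *\<^sub>R e2 p + v$3 *\<^sub>R e3 p)) $ i" for i
    unfolding dN_def e2_def e3_def a_def b_def g_def
      vector_add_component vector_minus_component vector_uminus_component vector_scaleR_component real_scaleR_def
    using t w by algebra
  then show ?thesis by (intro vec_eq_iff[THEN iffD2] allI)
qed

lemma N_has_derivative: "(N has_derivative dN p) (at p)"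
proof -
  note D = frame_deriv[OF p_I, THEN has_derivative_compose_component]
  have c: "((\<lambda>p. p$i) has_derivative (\<lambda>v. v$i)) (at p)" for i :: 3
    by (rule bounded_linear_imp_has_derivative) (rule bounded_linear_vec_nth)
  show ?thesis
    unfolding tubular_gauss_map_def[abs_def]
    by (rule has_derivative_eq_rhs, (rule D c has_derivative_minus has_derivative_add has_derivative_scaleR
          has_derivative_mult has_derivative_cos has_derivative_sin)+)
      (simp add: fun_eq_iff dN_eq e2_def e3_def algebra_simps)
qed

lemma X_has_derivative: "(X has_derivative dX p) (at p)"
proof -
  have X: "X = (\<lambda>p. \<beta> (p$1) - r *\<^sub>R N p)"
    by (simp add: fun_eq_iff tubular_hypersurface_def tubular_gauss_map_def algebra_simps)
  show ?thesis unfolding X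
    by (rule has_derivative_eq_rhs, rule has_derivative_diff,
        rule frame_deriv(1)[OF p_I, THEN has_derivative_compose_component],
        rule has_derivative_scaleR_right, rule N_has_derivative)
      (simp add: fun_eq_iff dX_def dN_def algebra_simps)
qed

lemma frechet_X: "frechet_derivative X (at p) = dX p"
  and frechet_N: "frechet_derivative N (at p) = dN p"
  using X_has_derivative N_has_derivative frechet_derivative_at by metis+

lemma inj_dX: "inj (dX p)"
  using immersion pU unfolding immersion_on_def frechet_X[symmetric] by blast

text \<open>Otherwise the coordinate vector of \<open>t\<close> would lie in the kernel of the
  injective map \<open>dX p\<close>.\<close>

lemma cos_w_nonzero: "cos (p$3) \<noteq> 0"
proof
  assume "cos (p$3) = 0"
  then have "dX p (vector [0,1,0]) = dX p 0" by (simp add: dX_def)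
  then have "vector [0,1,0] = (0 :: real^3)" by (rule injD[OF inj_dX])
  then show False by (simp add: vec_eq_iff forall_3)
qed

lemma f_nonzero: "1 + r * g p \<noteq> 0"
proof
  assume 0: "1 + r * g p = 0"
  \<comment> \<open>This vector cancels the \<open>e2\<close> and \<open>e3\<close> coefficients,
    leaving only \<open>1 + r * g p\<close> times \<open>F 1\<close>.\<close>
  have "dX p (vector [1, - a p / cos (p$3), - b p]) = dX p 0"
    using 0 cos_w_nonzero by (simp add: dX_def)
  then have "vector [1, - a p / cos (p$3), - b p] = (0 :: real^3)" by (rule injD[OF inj_dX])
  then show False by (simp add: vec_eq_iff forall_3)
qed

section \<open>Shape operator and mean curvatures\<close>

lemma one_minus_r_kappa: "1 - r * \<kappa> p = 1 / (1 + r * g p)"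
  using f_nonzero by (simp add: \<kappa>_def field_simps)

lemma det_shape: "det (mat x - shape_operator X N p) = (x - 1/r) * (x - 1/r) * (x - \<kappa> p)"
proof -
  define f where "f = 1 + r * g p"
  \<comment> \<open>Found by comparing frame coefficients in
    \<open>dX p (S *v v) = - dN p v\<close>. The off-diagonal entries carry the factor
    \<open>1/r - \<kappa> p = 1 / (f * r)\<close>; triangularity makes the eigenvalues
    visible.\<close>
  define S :: "real^3^3" where
    "S = vector [vector [\<kappa> p, 0, 0], vector [a p / (f * r * cos (p$3)), 1/r, 0], vector [b p / (f * r), 0, 1/r]]"
  have f: "f \<noteq> 0" using f_nonzero f_def by simp
  have S_v: "(S *v v)$1 = \<kappa> p * v$1" "(S *v v)$2 = a p / (f * r * cos (p$3)) * v$1 + v$2 / r"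
      "(S *v v)$3 = b p / (f * r) * v$1 + v$3 / r" for v
    by (simp_all add: S_def matrix_vector_mult_def sum_3)
  have dXS: "dX p (S *v v) = - dN p v" for v
  proof -
    have 1: "\<kappa> p * v$1 * f = v$1 * g p" using f by (simp add: \<kappa>_def f_def)
    have k: "r * \<kappa> p + 1 / f = 1" using one_minus_r_kappa f_def by simp
    have 2: "r * (\<kappa> p * v$1 * a p + (a p / (f * r * cos (p$3)) * v$1 + v$2 / r) * cos (p$3))
        = (r * \<kappa> p + 1 / f) * (v$1 * a p) + v$2 * cos (p$3)"
      using f r_pos cos_w_nonzero by (simp add: field_simps)
    have 3: "r * (\<kappa> p * v$1 * b p + (b p / (f * r) * v$1 + v$3 / r)) = (r * \<kappa> p + 1 / f) * (v$1 * b p) + v$3"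
      using f r_pos by (simp add: field_simps)
    show ?thesis unfolding dX_def dN_def S_v 2 3 f_def[symmetric] 1 k by simp
  qed
  have "shape_operator X N p = S"
    unfolding shape_operator_def frechet_X frechet_N
  proof (rule the_equality)
    show "\<forall>v. dX p (S *v v) = - dN p v" using dXS by blast
  next
    fix S' assume "\<forall>v. dX p (S' *v v) = - dN p v"
    then have "S' *v v = S *v v" for v using dXS inj_dX by (metis injD)
    then show "S' = S" by (simp add: matrix_eq)
  qed
  then show ?thesis
    by (simp add: det_3 S_def mat_def)
qed

lemma normal_sign: "normal_sign N p = 1"
  by (simp add: normal_sign_def adapted_frame_inner)

lemma mean_curvatures:
  "mean_curvature X N 1 p = (2 / r + \<kappa> p) / 3"
  "mean_curvature X N 2 p = (1 / r\<^sup>2 + 2 * \<kappa> p / r) / 3"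
  "mean_curvature X N 3 p = \<kappa> p / r\<^sup>2"
proof -
  have "(3 choose 2) = (3::nat)" by (simp add: numeral_eq_Suc)
  then show "mean_curvature X N 1 p = (2 / r + \<kappa> p) / 3"
  "mean_curvature X N 2 p = (1 / r\<^sup>2 + 2 * \<kappa> p / r) / 3"
  "mean_curvature X N 3 p = \<kappa> p / r\<^sup>2"
    unfolding mean_curvature_def normal_sign curvature_coeff_eq[OF det_shape]
    by (simp_all add: power2_eq_square field_simps)
qed

section \<open>The gradient and the derivative of the second mean curvature\<close>

text \<open>The definite description of the gradient needs existence and uniqueness; both come from
  expanding tangent vectors in the orthonormal frame \<open>F 1\<close>, \<open>e2\<close>,
  \<open>e3\<close>.\<close>

lemma gradient_inner:
  assumes f: "linear (frechet_derivative h (at p))"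
  defines "G \<equiv> hypersurface_gradient X h p"
  shows "lorentz G (dX p v) = frechet_derivative h (at p) v"
    and "lorentz G (N p) = 0"
proof -
  let ?d = "frechet_derivative h (at p)"
  define f0 where "f0 = 1 + r * g p"
  have f0: "f0 \<noteq> 0" using f_nonzero f0_def by simp
  \<comment> \<open>Preimages of the tangent frame under \<open>dX p\<close>.\<close>
  let ?u1 = "vector [1 / f0, - a p / (f0 * cos (p$3)), - b p / f0] :: real^3"
  let ?u2 = "vector [0, 1 / (r * cos (p$3)), 0] :: real^3"
  let ?u3 = "vector [0, 0, 1 / r] :: real^3"
  have dX_u: "dX p ?u1 = F 1 (p$1)" "dX p ?u2 = e2 p" "dX p ?u3 = e3 p"
    using f0 cos_w_nonzero r_pos by (simp_all add: dX_def f0_def[symmetric])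
  have v: "v = (v$1 * f0) *\<^sub>R ?u1 + (r * (v$1 * a p + v$2 * cos (p$3))) *\<^sub>R ?u2
      + (r * (v$1 * b p + v$3)) *\<^sub>R ?u3" for v :: "real^3"
    using f0 cos_w_nonzero r_pos by (simp add: vec_eq_iff forall_3) (simp add: field_simps)
  have dv: "?d v = (v$1 * f0) * ?d ?u1 + (r * (v$1 * a p + v$2 * cos (p$3))) * ?d ?u2
      + (r * (v$1 * b p + v$3)) * ?d ?u3" for v
    by (subst v) (simp add: linear_add[OF f] linear_scale[OF f])
  have lin: "linear (dX p)" using X_has_derivative has_derivative_linear by blast
  \<comment> \<open>The sign of the first coefficient is reversed because \<open>F 1\<close> is
    timelike.\<close>
  define G0 where "G0 = (- ?d ?u1) *\<^sub>R F 1 (p$1) + ?d ?u2 *\<^sub>R e2 p + ?d ?u3 *\<^sub>R e3 p"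
  have G0: "G0 \<in> range (dX p)"
    unfolding G0_def dX_u[symmetric] linear_scale[OF lin, symmetric] linear_add[OF lin, symmetric] by blast
  have G0': "lorentz G0 (dX p v) = ?d v" for v
    unfolding dv[of v] by (simp add: G0_def dX_def f0_def[symmetric] adapted_frame_inner algebra_simps)
  have tangent: "lorentz Y (N p) = 0" if "Y \<in> range (dX p)" for Y
    using that by (auto simp: dX_def adapted_frame_inner)
  have "G = G0"
    unfolding G_def hypersurface_gradient_def frechet_X
  proof (rule the_equality)
    show "G0 \<in> range (dX p) \<and> (\<forall>v. lorentz G0 (dX p v) = ?d v)" using G0 G0' by blast
  next
    fix Y assume Y: "Y \<in> range (dX p) \<and> (\<forall>v. lorentz Y (dX p v) = ?d v)"
    then obtain y where y: "Y = dX p y" by blast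
    from Y have *: "lorentz Y (dX p v) = lorentz G0 (dX p v)" for v using G0' by simp
    have "y$1 * f0 = - ?d ?u1" "r * (y$1 * a p + y$2 * cos (p$3)) = ?d ?u2"
      "r * (y$1 * b p + y$3) = ?d ?u3"
      using *[of ?u1] *[of ?u2] *[of ?u3] unfolding dX_u y G0_def dX_def[of p y] f0_def[symmetric]
      by (simp_all add: adapted_frame_inner)
    then show "Y = G0" unfolding y G0_def dX_def f0_def[symmetric] by simp
  qed
  then show "lorentz G (dX p v) = ?d v" "lorentz G (N p) = 0"
    using G0' tangent[OF G0] by auto
qed

lemma g_has_derivative: "(g has_derivative dg p) (at p)"
proof -
  have c: "((\<lambda>p. p$i) has_derivative (\<lambda>v. v$i)) (at p)" for i :: 3
    by (rule bounded_linear_imp_has_derivative) (rule bounded_linear_vec_nth)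
  show ?thesis
    unfolding g_def[abs_def]
    by (rule has_derivative_eq_rhs,
        (rule k1_deriv[OF p_I, THEN has_derivative_compose_component] c
          has_derivative_mult has_derivative_cos has_derivative_sin)+)
      (simp add: fun_eq_iff dg_def algebra_simps)
qed

end

lemma H2_has_derivative:
  assumes pU: "p \<in> U"
  shows "(mean_curvature X N 2 has_derivative (\<lambda>v. 2 / (3 * r) * (dg p v / (1 + r * g p)\<^sup>2))) (at p)"
proof -
  have f: "1 + r * g p \<noteq> 0" by (rule f_nonzero[OF pU])
  \<comment> \<open>The second mean curvature as a function of \<open>g\<close> alone.\<close>
  let ?h = "\<lambda>y. 1 / (3 * r\<^sup>2) + 2 / (3 * r) * (y / (1 + r * y))"
  have "((\<lambda>y. y / (1 + r * y)) has_field_derivative 1 / (1 + r * g p)\<^sup>2) (at (g p))"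
    by (rule derivative_eq_intros f refl)+ (simp add: power2_eq_square)
  then have "(?h has_field_derivative 2 / (3 * r) * (1 / (1 + r * g p)\<^sup>2)) (at (g p))"
    by (rule DERIV_add[OF DERIV_const DERIV_cmult, THEN DERIV_cong]) (rule add_0_left)
  then have "((\<lambda>y. ?h (g y)) has_derivative (\<lambda>v. dg p v * (2 / (3 * r) * (1 / (1 + r * g p)\<^sup>2)))) (at p)"
    using g_has_derivative[OF pU] by (rule DERIV_compose_FDERIV)
  then have "((\<lambda>y. ?h (g y)) has_derivative (\<lambda>v. 2 / (3 * r) * (dg p v / (1 + r * g p)\<^sup>2))) (at p)"
    by (simp add: mult_ac)
  \<comment> \<open>The formula in \<open>g\<close> is available only at points of \<open>U\<close>,
    so openness of \<open>U\<close> carries the derivative over.\<close>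
  then show ?thesis
    by (rule has_derivative_transform_within_open[OF _ openU pU])
      (simp only: mean_curvatures(2) \<kappa>_def[symmetric], simp add: add_divide_distrib)
qed

section \<open>Scalar equations forced by the pointwise 1-type condition\<close>

lemma pointwise_equation:
  assumes pU: "p \<in> U" and eq: "L1_gauss_map X N p = m *\<^sub>R (N p + C)"
  shows "dg p v * (1 + lorentz (N p) C) * r\<^sup>2 = (1 + 3 * r * g p + 3 * (r * g p)\<^sup>2) * lorentz C (dX p v)"
proof -
  define G where "G = hypersurface_gradient X (mean_curvature X N 2) p"
  define f where "f = 1 + r * g p"
  have f: "f \<noteq> 0" using f_nonzero[OF pU] f_def by simp
  \<comment> \<open>Up to the factor \<open>2 / (3 * r)\<close> this is the normal coefficient
    \<open>3 H1 H2 - H3\<close>.\<close>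
  define q where "q = 1 / r\<^sup>2 + \<kappa> p / r + (\<kappa> p)\<^sup>2"
  have fd: "frechet_derivative (mean_curvature X N 2) (at p) = (\<lambda>v. 2 / (3 * r) * (dg p v / f\<^sup>2))"
    using H2_has_derivative[OF pU] frechet_derivative_at f_def by metis
  have lin: "linear (frechet_derivative (mean_curvature X N 2) (at p))"
    using H2_has_derivative[OF pU] by (metis frechet_derivative_at has_derivative_linear)
  have "(3 choose 2) = (3::nat)" by (simp add: numeral_eq_Suc)
  moreover have "3 * ((2 / r + \<kappa> p) / 3) * ((1 / r\<^sup>2 + 2 * \<kappa> p / r) / 3) - \<kappa> p / r\<^sup>2 = 2 / (3 * r) * q"
    using r_pos by (simp add: q_def power2_eq_square field_simps)
  ultimately have eq': "3 *\<^sub>R (G + (2 / (3 * r) * q) *\<^sub>R N p) = m *\<^sub>R (N p + C)"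
    using eq unfolding L1_gauss_map_def normal_sign[OF pU] mean_curvatures[OF pU] Let_def G_def by simp
  have NX: "lorentz (N p) (dX p v) = 0" by (simp add: dX_def adapted_frame_inner[OF pU])
  have T: "2 / r * (dg p v / f\<^sup>2) = m * lorentz C (dX p v)"
    using arg_cong[OF eq', of "\<lambda>x. lorentz x (dX p v)"]
      gradient_inner(1)[OF pU lin, of v] NX by (simp add: G_def fd)
  have n: "2 / r * q = m * (1 + lorentz (N p) C)"
    using arg_cong[OF eq', of "\<lambda>x. lorentz x (N p)"] gradient_inner(2)[OF pU lin]
    by (simp add: G_def adapted_frame_inner[OF pU] lorentz_commute)
  \<comment> \<open>Cross-multiplying \<open>T\<close> and \<open>n\<close> makes \<open>m\<close>
    cancel without dividing by \<open>m\<close> or by \<open>1 + lorentz (N p) C\<close>.\<close>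
  have "2 / r * (dg p v / f\<^sup>2 * (1 + lorentz (N p) C)) = 2 / r * (q * lorentz C (dX p v))"
    unfolding mult.assoc[symmetric] T n by simp
  moreover have "2 / r \<noteq> 0" using r_pos by simp
  ultimately have "dg p v / f\<^sup>2 * (1 + lorentz (N p) C) = q * lorentz C (dX p v)"
    using mult_left_cancel by blast
  then have *: "dg p v * (1 + lorentz (N p) C) = (q * f\<^sup>2) * lorentz C (dX p v)"
    using f by (simp add: field_simps)
  have "q * f\<^sup>2 * r\<^sup>2 = 1 + 3 * r * g p + 3 * (r * g p)\<^sup>2"
  proof -
    have "\<kappa> p * f = g p" using f by (simp add: \<kappa>_def f_def)
    moreover have "q * f\<^sup>2 * r\<^sup>2 = f\<^sup>2 + r * f * (\<kappa> p * f) + r\<^sup>2 * (\<kappa> p * f)\<^sup>2"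
      using r_pos by (simp add: q_def power2_eq_square field_simps)
    ultimately show ?thesis by (simp add: f_def power2_eq_square algebra_simps)
  qed
  with * show ?thesis by (metis mult.assoc mult.commute)
qed

text \<open>In the direction of \<open>t\<close>, \<open>dX p v\<close> is
  \<open>r * cos (p$3)\<close> times \<open>e2 p\<close>, and this nonzero factor is
  cancelled.\<close>

lemma pointwise_equation_t:
  assumes pU: "p \<in> U" and eq: "L1_gauss_map X N p = m *\<^sub>R (N p + C)"
  shows "- k1 (p$1) * sin (p$2) * (1 + lorentz (N p) C) * r
    = (1 + 3 * r * g p + 3 * (r * g p)\<^sup>2) * lorentz (e2 p) C"
proof -
  have "(r * cos (p$3)) * (- k1 (p$1) * sin (p$2) * (1 + lorentz (N p) C) * r)
    = (r * cos (p$3)) * ((1 + 3 * r * g p + 3 * (r * g p)\<^sup>2) * lorentz (e2 p) C)"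
    using pointwise_equation[OF pU eq, of "vector [0, 1, 0]"]
    by (simp add: dg_def dX_def lorentz_commute[of C] power2_eq_square mult_ac)
  moreover have nz: "r * cos (p$3) \<noteq> 0" using r_pos cos_w_nonzero[OF pU] by simp
  ultimately show ?thesis unfolding mult_left_cancel[OF nz] by blast
qed

lemma pointwise_equation_w:
  assumes pU: "p \<in> U" and eq: "L1_gauss_map X N p = m *\<^sub>R (N p + C)"
  shows "- k1 (p$1) * cos (p$2) * sin (p$3) * (1 + lorentz (N p) C) * r
    = (1 + 3 * r * g p + 3 * (r * g p)\<^sup>2) * lorentz (e3 p) C"
proof -
  have "r * (- k1 (p$1) * cos (p$2) * sin (p$3) * (1 + lorentz (N p) C) * r)
    = r * ((1 + 3 * r * g p + 3 * (r * g p)\<^sup>2) * lorentz (e3 p) C)"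
    using pointwise_equation[OF pU eq, of "vector [0, 0, 1]"]
    by (simp add: dg_def dX_def lorentz_commute[of C] power2_eq_square mult_ac)
  moreover have nz: "r \<noteq> 0" using r_pos by simp
  ultimately show ?thesis unfolding mult_left_cancel[OF nz] by blast
qed

section \<open>Elimination of the constant vector\<close>

text \<open>Only the angular equations enter, so \<open>s\<close> stays fixed and the products
  \<open>c i\<close> of \<open>C\<close> with the frame are constants while \<open>t\<close> and
  \<open>w\<close> vary.\<close>

lemma vanishing_on_slices:
  assumes eq: "\<forall>p\<in>U. L1_gauss_map X N p = m p *\<^sub>R (N p + C)"
    and s: "s \<in> I"
  shows "k1 s = 0" "lorentz (F 2 s) C = 0" "lorentz (F 3 s) C = 0" "lorentz (F 4 s) C = 0"
proof -
  obtain q where q: "q \<in> U" "q$1 = s" using s U_proj by auto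
  obtain e where e: "e > 0" "ball q e \<subseteq> U" using openU q(1) openE by blast
  \<comment> \<open>With half the radius for each angle, the l1 bound on the norm keeps the whole
    rectangle inside the slice of \<open>U\<close>.\<close>
  define T where "T = {q$2 - e/2 <..< q$2 + e/2}"
  define W where "W = {q$3 - e/2 <..< q$3 + e/2}"
  have inU: "vector [s, t, w] \<in> U" if "t \<in> T" "w \<in> W" for t w
  proof -
    have "norm (vector [s, t, w] - q) \<le> (\<Sum>i\<in>UNIV. \<bar>(vector [s, t, w] - q) $ i\<bar>)"
      by (rule norm_le_l1_cart)
    also have "\<dots> = \<bar>t - q$2\<bar> + \<bar>w - q$3\<bar>" using q(2) by (simp add: sum_3)
    also have "\<dots> < e" using that by (simp add: T_def W_def abs_if)
    finally show ?thesis using e(2) by (auto simp: dist_norm norm_minus_commute)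
  qed
  define c where "c i = lorentz (F i s) C" for i
  define P where "P t w = 1 + 3 * r * (k1 s * cos t * cos w) + 3 * (r * (k1 s * cos t * cos w))\<^sup>2" for t w
  define h where "h t w = cos t * cos w * c 2 + sin t * cos w * c 3 + sin w * c 4" for t w
  \<comment> \<open>Completing the square in \<open>r * g\<close> shows that the quadratic has no
    real zero, so \<open>P\<close> can always be cancelled.\<close>
  have P_pos: "P t w > 0" for t w
  proof -
    have "P t w = 3 * (r * (k1 s * cos t * cos w) + 1/2)\<^sup>2 + 1/4"
      by (simp add: P_def power2_eq_square algebra_simps)
    then show ?thesis by (simp add: add_nonneg_pos)
  qed
  have cos_w: "cos w \<noteq> 0" if "t \<in> T" "w \<in> W" for t w
    using cos_w_nonzero[OF inU[OF that]] by simp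
  have eq_t: "- k1 s * sin t * (1 - h t w) * r = P t w * (cos t * c 3 - sin t * c 2)"
    and eq_w: "- k1 s * cos t * sin w * (1 - h t w) * r
      = P t w * (cos w * c 4 - cos t * sin w * c 2 - sin t * sin w * c 3)"
    if "t \<in> T" "w \<in> W" for t w
  proof -
    let ?p = "vector [s, t, w] :: real^3"
    have "lorentz (N ?p) C = - h t w" "lorentz (e2 ?p) C = cos t * c 3 - sin t * c 2"
      "lorentz (e3 ?p) C = cos w * c 4 - cos t * sin w * c 2 - sin t * sin w * c 3"
      "1 + 3 * r * g ?p + 3 * (r * g ?p)\<^sup>2 = P t w"
      by (simp_all add: g_def e2_def e3_def tubular_gauss_map_def P_def h_def c_def)
    then show "- k1 s * sin t * (1 - h t w) * r = P t w * (cos t * c 3 - sin t * c 2)"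
      "- k1 s * cos t * sin w * (1 - h t w) * r
      = P t w * (cos w * c 4 - cos t * sin w * c 2 - sin t * sin w * c 3)"
      using pointwise_equation_t[OF inU[OF that] bspec[OF eq inU[OF that]]]
        pointwise_equation_w[OF inU[OF that] bspec[OF eq inU[OF that]]]
      by simp_all
  qed
  \<comment> \<open>Weighting \<open>eq_t\<close> by \<open>cos t * sin w\<close> and
    \<open>eq_w\<close> by \<open>sin t\<close> equates their left sides; on the right the
    \<open>c 2\<close> terms cancel.\<close>
  have c34: "sin w * c 3 = sin t * cos w * c 4" if "t \<in> T" "w \<in> W" for t w
  proof -
    have "cos t * sin w * (P t w * (cos t * c 3 - sin t * c 2))
      = sin t * (P t w * (cos w * c 4 - cos t * sin w * c 2 - sin t * sin w * c 3))"
      unfolding eq_t[OF that, symmetric] eq_w[OF that, symmetric] by simp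
    then have "P t w * (sin w * c 3 - sin t * cos w * c 4) = 0"
      using sin_cos_squared_add[of t] by algebra
    then show ?thesis using P_pos[of t w] by simp
  qed
  have q23: "q$2 \<in> T" "q$3 \<in> W" using e(1) by (auto simp: T_def W_def)
  have infT: "infinite (sin ` T)" and infT': "infinite (cos ` {t \<in> T. sin t \<noteq> 0})"
    and infW: "infinite (sin ` W)"
    unfolding T_def W_def using e(1) by - (rule infinite_sin_image infinite_cos_image, simp)+
  \<comment> \<open>At fixed \<open>w\<close>, a nonzero \<open>c 4\<close> would make
    \<open>sin t\<close> constant on \<open>T\<close>.\<close>
  have c4: "c 4 = 0"
  proof (rule ccontr)
    assume "c 4 \<noteq> 0"
    then have "sin t = sin (q$3) * c 3 / (cos (q$3) * c 4)" if "t \<in> T" for t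
      using c34[OF that q23(2)] cos_w[OF that q23(2)] by (simp add: field_simps)
    then have "sin ` T \<subseteq> {sin (q$3) * c 3 / (cos (q$3) * c 4)}" by blast
    then show False using infT finite_subset by blast
  qed
  have c3: "c 3 = 0"
  proof (rule ccontr)
    assume "c 3 \<noteq> 0"
    then have "sin ` W \<subseteq> {0}" using c34[OF q23(1)] c4 by auto
    then show False using infW finite_subset by blast
  qed
  define x where "x = cos (q$3)"
  have x: "x \<noteq> 0" using cos_w[OF q23] by (simp add: x_def)
  \<comment> \<open>The difference of the two sides of \<open>eq_t\<close> after division by
    \<open>sin t\<close>, as a polynomial in \<open>cos t\<close> at fixed \<open>w\<close>, using
    \<open>c 3 = c 4 = 0\<close>.\<close>
  define Q where "Q = [:c 2 - k1 s * r, (3 * r * k1 s * c 2 + k1 s * r * c 2) * x, 3 * (r * k1 s * x)\<^sup>2 * c 2:]"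
  have "poly Q y = 0" if "y \<in> cos ` {t \<in> T. sin t \<noteq> 0}" for y
  proof -
    from that obtain t where t: "y = cos t" "t \<in> T" "sin t \<noteq> 0" by auto
    have "sin t * (k1 s * (1 - cos t * x * c 2) * r) = sin t * (P t (q$3) * c 2)"
      using eq_t[OF t(2) q23(2)] by (simp add: c3 c4 h_def x_def mult_ac)
    then have *: "k1 s * (1 - cos t * x * c 2) * r = P t (q$3) * c 2"
      unfolding mult_left_cancel[OF t(3)] .
    have "poly Q y = P t (q$3) * c 2 - k1 s * (1 - cos t * x * c 2) * r"
      unfolding Q_def t(1) P_def x_def[symmetric]
      by (simp add: power2_eq_square ring_distribs mult_ac)
    also have "\<dots> = 0" unfolding * by (rule diff_self)
    finally show ?thesis .
  qed
  then have "cos ` {t \<in> T. sin t \<noteq> 0} \<subseteq> {y. poly Q y = 0}" by blast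
  then have "infinite {y. poly Q y = 0}" using infT' finite_subset by blast
  then have "Q = 0" using poly_roots_finite by blast
  \<comment> \<open>The leading coefficient forces \<open>k1 s\<close> or \<open>c 2\<close> to
    vanish, and the constant one, \<open>c 2 = k1 s * r\<close>, then kills the other.\<close>
  then have "c 2 - k1 s * r = 0" and "3 * (r * k1 s * x)\<^sup>2 * c 2 = 0"
    unfolding Q_def pCons_eq_0_iff by blast+
  moreover from this have "k1 s = 0 \<or> c 2 = 0" using r_pos x by simp
  ultimately have "k1 s = 0" "c 2 = 0" using r_pos by auto
  then show "k1 s = 0" "lorentz (F 2 s) C = 0" "lorentz (F 3 s) C = 0" "lorentz (F 4 s) C = 0"
    using c3 c4 by (simp_all add: c_def)
qed

lemma constant_vector_zero:
  assumes eq: "\<forall>p\<in>U. L1_gauss_map X N p = m p *\<^sub>R (N p + C)"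
    and p: "p \<in> U"
  shows "C = 0"
proof -
  define s where "s = p$1"
  have s: "s \<in> I" using p_I[OF p] s_def by simp
  note van = vanishing_on_slices[OF eq]
  \<comment> \<open>The slice argument applies at every point of the open set \<open>I\<close>, so
    the derivative of \<open>k1\<close> vanishes too.\<close>
  have "(k1 has_field_derivative 0) (at s)"
    by (rule has_field_derivative_transform_within_open[OF DERIV_const[of 0] openI s]) (simp add: van(1))
  then have "deriv k1 s = 0" by (rule DERIV_imp_deriv)
  then have "dg p v = 0" for v using van(1)[OF s] by (simp add: dg_def s_def)
  moreover have "g p = 0" using van(1)[OF s] by (simp add: g_def s_def)
  ultimately have "lorentz C (dX p (vector [1, 0, 0])) = 0"
    using pointwise_equation[OF p bspec[OF eq p], of "vector [1, 0, 0]"] by simp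
  \<comment> \<open>The \<open>e2\<close> and \<open>e3\<close> parts of \<open>dX\<close> are
    combinations of \<open>F 2\<close>, \<open>F 3\<close>, \<open>F 4\<close>, already orthogonal
    to \<open>C\<close>; with \<open>g p = 0\<close> only \<open>F 1\<close> remains.\<close>
  then have 1: "lorentz (F 1 s) C = 0"
    using van[OF s] \<open>g p = 0\<close>
    by (simp add: dX_def e2_def e3_def s_def lorentz_commute[of C])
  show ?thesis
  proof (rule orthonormal_frame_complete[of "\<lambda>i. F i s"])
    fix i show "lorentz (F i s) C = 0"
      using 1 van(2-4)[OF s] exhaust_4[of i] by auto
  qed (rule frame_inner[OF s])
qed

end

theorem theorem2:
  fixes I :: "real set" and U :: "(real^3) set"
    and \<beta> :: "real \<Rightarrow> real^4" and F :: "4 \<Rightarrow> real \<Rightarrow> real^4"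
    and k1 k2 k3 :: "real \<Rightarrow> real" and r :: real
  assumes "open I" and "is_interval I" and "I \<noteq> {}"
    and "timelike_frenet_curve I \<beta> F k1 k2 k3"
    and "r > 0"
    and "open U" and "connected U" and "(\<lambda>p. p$1) ` U = I"
    and "immersion_on U (tubular_hypersurface \<beta> F r)"
  shows "\<not> second_kind_L1_pointwise_1_type U (tubular_hypersurface \<beta> F r) (tubular_gauss_map F)"
proof
  interpret tubular_frenet I U \<beta> F k1 k2 k3 r
    using assms by unfold_locales
  assume "second_kind_L1_pointwise_1_type U (tubular_hypersurface \<beta> F r) (tubular_gauss_map F)"
  then obtain m C p where "C \<noteq> 0" "p \<in> U"
    and "\<forall>p\<in>U. L1_gauss_map X N p = m p *\<^sub>R (N p + C)"
    unfolding second_kind_L1_pointwise_1_type_def by blast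
  then show False using constant_vector_zero by blast
qed

end
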